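(* Let $\mathfrak g=\mathfrak g_{3,1}$ be the three-dimensional real Lie algebra with basis $e_1,e_2,e_3$ whose only nonzero bracket is $[e_1,e_2]=e_3$, and let $(\mathfrak g,\nabla)$ be a flat Lie algebra. Then $(\mathfrak g,\nabla)$ is isomorphic to exactly one of the following flat Lie algebras (only nonzero products $e_ie_j=\nabla_{e_i}e_j$ are listed): $\mathfrak h_{0,1}$: $e_1e_1=e_1,\ e_1e_2=e_3$. $\mathfrak h_{0,2}$: $e_1e_1=e_2,\ e_1e_2=e_3$. $\mathfrak h_{0,3}$: $e_1e_2=e_3$. $\mathfrak h_{0,4}$: $e_1e_1=e_1,\ e_1e_2=e_2+e_3,\ e_1e_3=e_3,\ e_2e_1=e_2,\ e_3e_1=e_3$. $\mathfrak h_{0,5}$: $e_1e_1=e_2,\ e_1e_2=(1+\lambda)e_3,\ e_2e_1=\lambda e_3$; $\lambda\in\mathbb R\setminus\{0\}$. $\mathfrak h_{0,6}$: $e_1e_2=\frac12e_3,\ e_2e_1=-\frac12e_3$. $\mathfrak h_{1,1}$: $e_1e_1=e_3,\ e_2e_1=-e_3,\ e_2e_2=e_2$. $\mathfrak h_{4,1}$: $e_1e_1=e_3,\ e_1e_2=e_1,\ e_2e_1=e_1-e_3,\ e_2e_2=e_2,\ e_2e_3=e_3,\ e_3e_2=e_3$. $\mathfrak h_{6,1}$: $e_1e_1=\lambda e_3,\ e_1e_2=e_3,\ e_2e_2=e_3$; $\lambda\in\mathbb R\setminus\{0\}$.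
   Context: A connection on a real Lie algebra $\mathfrak g$ is a bilinear map $\nabla:\mathfrak g\times\mathfrak g\to\mathfrak g$, $(X,Y)\mapsto\nabla_XY$. It is torsion-free if $\nabla_XY-\nabla_YX=[X,Y]$ for all $X,Y$, and flat if $\nabla_X\nabla_YZ-\nabla_Y\nabla_XZ-\nabla_{[X,Y]}Z=0$ for all $X,Y,Z$. A flat Lie algebra is a pair $(\mathfrak g,\nabla)$ with $\nabla$ a flat, torsion-free connection on $\mathfrak g$. Two flat torsion-free connections $\nabla^1,\nabla^2$ on $\mathfrak g$ are isomorphic if there is a Lie algebra automorphism $\Psi$ of $\mathfrak g$ with $\nabla^2_X=\Psi\circ\nabla^1_{\Psi^{-1}(X)}\circ\Psi^{-1}$ for all $X\in\mathfrak g$. Each admissible choice of the parameters gives a flat Lie algebra of the list. *)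

theory Defs
  imports "HOL-Analysis.Analysis"
begin

definition lie_algebra :: "('a::real_vector \<Rightarrow> 'a \<Rightarrow> 'a) \<Rightarrow> bool" where
  "lie_algebra br \<longleftrightarrow> bilinear br \<and> (\<forall>x. br x x = 0) \<and>
     (\<forall>x y z. br x (br y z) + br y (br z x) + br z (br x y) = 0)"

text \<open>A connection is a bilinear map \<open>nabla\<close>, with \<open>nabla x y\<close> for \<open>\<nabla>\<^sub>x y\<close>.\<close>

definition torsion_free :: "('a::real_vector \<Rightarrow> 'a \<Rightarrow> 'a) \<Rightarrow> ('a \<Rightarrow> 'a \<Rightarrow> 'a) \<Rightarrow> bool" where
  "torsion_free br nabla \<longleftrightarrow> (\<forall>x y. nabla x y - nabla y x = br x y)"

definition flat :: "('a::real_vector \<Rightarrow> 'a \<Rightarrow> 'a) \<Rightarrow> ('a \<Rightarrow> 'a \<Rightarrow> 'a) \<Rightarrow> bool" where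
  "flat br nabla \<longleftrightarrow>
     (\<forall>x y z. nabla x (nabla y z) - nabla y (nabla x z) - nabla (br x y) z = 0)"

definition flat_lie_algebra :: "('a::real_vector \<Rightarrow> 'a \<Rightarrow> 'a) \<Rightarrow> ('a \<Rightarrow> 'a \<Rightarrow> 'a) \<Rightarrow> bool" where
  "flat_lie_algebra br nabla \<longleftrightarrow>
     lie_algebra br \<and> bilinear nabla \<and> torsion_free br nabla \<and> flat br nabla"

definition lie_automorphism :: "('a::real_vector \<Rightarrow> 'a \<Rightarrow> 'a) \<Rightarrow> ('a \<Rightarrow> 'a) \<Rightarrow> bool" where
  "lie_automorphism br \<Psi> \<longleftrightarrow>
     linear \<Psi> \<and> bij \<Psi> \<and> (\<forall>x y. \<Psi> (br x y) = br (\<Psi> x) (\<Psi> y))"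

definition isomorphic_connections ::
    "('a::real_vector \<Rightarrow> 'a \<Rightarrow> 'a) \<Rightarrow> ('a \<Rightarrow> 'a \<Rightarrow> 'a) \<Rightarrow> ('a \<Rightarrow> 'a \<Rightarrow> 'a) \<Rightarrow> bool" where
  "isomorphic_connections br nabla1 nabla2 \<longleftrightarrow>
     (\<exists>\<Psi>. lie_automorphism br \<Psi> \<and> (\<forall>x. nabla2 x = \<Psi> \<circ> nabla1 (inv \<Psi> x) \<circ> inv \<Psi>))"

abbreviation e1 :: "real^3" where "e1 \<equiv> axis 1 1"
abbreviation e2 :: "real^3" where "e2 \<equiv> axis 2 1"
abbreviation e3 :: "real^3" where "e3 \<equiv> axis 3 1"

text \<open>The bilinear product on \<open>real^3\<close> whose products of standard basis vectors are
  \<open>e\<^sub>i e\<^sub>j = v\<close> for the listed triples \<open>(i, j, v)\<close> and zero for all other pairs \<open>(i, j)\<close>;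
  no pair is to be listed twice.\<close>

definition bilinear_of_table :: "(3 \<times> 3 \<times> (real^3)) list \<Rightarrow> real^3 \<Rightarrow> real^3 \<Rightarrow> real^3" where
  "bilinear_of_table t x y = (\<Sum>(i, j, v)\<leftarrow>t. (x $ i * y $ j) *\<^sub>R v)"

definition g31 :: "real^3 \<Rightarrow> real^3 \<Rightarrow> real^3" where
  "g31 = bilinear_of_table [(1, 2, e3), (2, 1, - e3)]"

text \<open>Labels of the normal forms. For the two families the parameter is part of the label,
  so that distinct parameters count as distinct members of the list.\<close>

datatype label = H01 | H02 | H03 | H04 | H05 real | H06 | H11 | H41 | H61 real

fun admissible :: "label \<Rightarrow> bool" where
  "admissible (H05 l) \<longleftrightarrow> l \<noteq> 0"
| "admissible (H61 l) \<longleftrightarrow> l \<noteq> 0"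
| "admissible _ \<longleftrightarrow> True"

fun normal_form :: "label \<Rightarrow> real^3 \<Rightarrow> real^3 \<Rightarrow> real^3" where
  "normal_form H01 = bilinear_of_table [(1, 1, e1), (1, 2, e3)]"
| "normal_form H02 = bilinear_of_table [(1, 1, e2), (1, 2, e3)]"
| "normal_form H03 = bilinear_of_table [(1, 2, e3)]"
| "normal_form H04 = bilinear_of_table
     [(1, 1, e1), (1, 2, e2 + e3), (1, 3, e3), (2, 1, e2), (3, 1, e3)]"
| "normal_form (H05 l) = bilinear_of_table
     [(1, 1, e2), (1, 2, (1 + l) *\<^sub>R e3), (2, 1, l *\<^sub>R e3)]"
| "normal_form H06 = bilinear_of_table [(1, 2, (1/2) *\<^sub>R e3), (2, 1, - ((1/2) *\<^sub>R e3))]"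
| "normal_form H11 = bilinear_of_table [(1, 1, e3), (2, 1, - e3), (2, 2, e2)]"
| "normal_form H41 = bilinear_of_table
     [(1, 1, e3), (1, 2, e1), (2, 1, e1 - e3), (2, 2, e2), (2, 3, e3), (3, 2, e3)]"
| "normal_form (H61 l) = bilinear_of_table [(1, 1, l *\<^sub>R e3), (1, 2, e3), (2, 2, e3)]"

end

theory Submission
  imports Defs
begin

text \<open>Write \<open>L\<^sub>x = P x\<close> for the left multiplications. Torsion-freeness makes \<open>e\<^sub>3\<close> commute with
  everything, and flatness makes \<open>L\<close> of \<open>e\<^sub>3\<close> a commutator of matrices that commutes with all \<open>L\<^sub>x\<close>. In
  dimension three such a matrix has trace and square zero, hence rank at most one, and one finds
  \<open>e\<^sub>3 x = f(x) e\<^sub>3\<close> for a multiplicative linear form \<open>f\<close> vanishing on \<open>e\<^sub>3\<close>. If \<open>f \<noteq> 0\<close>, a basis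
  adapted to \<open>f\<close> leads to \<open>H04\<close> or \<open>H41\<close>. If \<open>f = 0\<close>, the product descends to a commutative
  associative product on the plane \<open>\<real>\<^sup>3 / \<langle>e\<^sub>3\<rangle>\<close>, which cannot have a unit. Either this product is
  generated by one element, which is nilpotent (\<open>H02\<close>, \<open>H05\<close>) or yields an idempotent
  (\<open>H01\<close>, \<open>H11\<close>), or it vanishes; then the connection is a bilinear form with values in the
  centre, classified by the discriminant of its symmetric part (\<open>H03\<close>, \<open>H06\<close>, \<open>H61\<close>). The
  parameter \<open>\<lambda>\<close> of \<open>H05\<close> is determined by \<open>(x x) x = \<lambda> (x (x x) - (x x) x)\<close>.\<close>

section \<open>The Heisenberg algebra\<close>

text \<open>The determinant of the classes of \<open>x\<close> and \<open>y\<close> in the plane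
  modulo the centre. It turns bracket computations into scalar ones.\<close>

definition area :: "real^3 \<Rightarrow> real^3 \<Rightarrow> real" where
  "area x y = x $ 1 * y $ 2 - x $ 2 * y $ 1"

lemma g31_eq: "g31 x y = area x y *\<^sub>R e3"
  by (simp add: g31_def bilinear_of_table_def area_def algebra_simps)

lemma area_simps [simp]:
  "area (x + y) w = area x w + area y w" "area w (x + y) = area w x + area w y"
  "area (x - y) w = area x w - area y w" "area w (x - y) = area w x - area w y"
  "area (c *\<^sub>R x) w = c * area x w" "area w (c *\<^sub>R x) = c * area w x"
  "area (- x) w = - area x w" "area w (- x) = - area w x"
  "area 0 w = 0" "area w 0 = 0" "area x x = 0" "area e3 w = 0" "area w e3 = 0"
  by (simp_all add: area_def algebra_simps axis_def)

lemma area_commute: "area y x = - area x y"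
  by (simp add: area_def)

lemma vec3_eq_iff: "(x::real^3) = y \<longleftrightarrow> x $ 1 = y $ 1 \<and> x $ 2 = y $ 2 \<and> x $ 3 = y $ 3"
  by (simp add: vec_eq_iff forall_3)

lemma axis3_nth [simp]:
  "e1 $ 1 = 1" "e1 $ 2 = 0" "e1 $ 3 = 0"
  "e2 $ 1 = 0" "e2 $ 2 = 1" "e2 $ 3 = 0"
  "e3 $ 1 = 0" "e3 $ 2 = 0" "e3 $ 3 = 1"
  by (simp_all add: axis_def)

lemma bilinear_table: "bilinear (bilinear_of_table t)"
proof -
  have "bilinear_of_table t (x + y) z = bilinear_of_table t x z + bilinear_of_table t y z"
    "bilinear_of_table t z (x + y) = bilinear_of_table t z x + bilinear_of_table t z y"
    "bilinear_of_table t (c *\<^sub>R x) z = c *\<^sub>R bilinear_of_table t x z"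
    "bilinear_of_table t z (c *\<^sub>R x) = c *\<^sub>R bilinear_of_table t z x" for x y z c
    by (induction t) (auto simp: bilinear_of_table_def algebra_simps)
  then show ?thesis
    by (simp add: bilinear_def linear_iff)
qed

lemma bilinear_normal_form: "bilinear (normal_form h)"
  by (cases h) (simp_all add: bilinear_table)

lemma lie_algebra_g31: "lie_algebra g31"
  by (simp add: lie_algebra_def g31_eq) (simp add: g31_def bilinear_table)

lemma torsion_free_normal_form: "torsion_free g31 (normal_form h)"
  by (cases h)
    (simp_all add: torsion_free_def g31_eq area_def bilinear_of_table_def vec3_eq_iff algebra_simps)

lemma flat_normal_form: "flat g31 (normal_form h)"
  by (cases h)
    (simp_all add: flat_def g31_eq area_def bilinear_of_table_def vec3_eq_iff algebra_simps)

lemma flat_lie_algebra_normal_form: "flat_lie_algebra g31 (normal_form h)"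
  by (simp add: flat_lie_algebra_def lie_algebra_g31 bilinear_normal_form
      torsion_free_normal_form flat_normal_form)

section \<open>Isomorphisms and invariants\<close>

lemma isomorphic_connectionsE:
  assumes "isomorphic_connections br P Q"
  obtains \<Psi> where "lie_automorphism br \<Psi>" "\<And>x y. \<Psi> (P x y) = Q (\<Psi> x) (\<Psi> y)"
proof -
  obtain \<Psi> where \<Psi>: "lie_automorphism br \<Psi>" "\<And>x. Q x = \<Psi> \<circ> P (inv \<Psi> x) \<circ> inv \<Psi>"
    using assms by (auto simp: isomorphic_connections_def)
  then have "inj \<Psi>"
    by (auto simp: lie_automorphism_def bij_def)
  then show ?thesis
    using that[OF \<Psi>(1)] by (simp add: \<Psi>(2))
qed

text \<open>The isomorphism is \<open>inv T\<close>. The map \<open>T\<close> runs from the normal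
  form \<open>Q\<close> to the given product \<open>P\<close>, the direction in which an adapted
  basis provides it.\<close>

lemma isomorphic_connectionsI:
  assumes T: "lie_automorphism br T" and PQ: "\<And>x y. P (T x) (T y) = T (Q x y)"
  shows "isomorphic_connections br P Q"
proof -
  have lin: "linear T" and bij: "bij T" and br: "\<And>x y. T (br x y) = br (T x) (T y)"
    using T by (auto simp: lie_automorphism_def)
  have inj: "inj T" and surj: "surj T"
    using bij by (auto simp: bij_def)
  have "linear (inv T)"
  proof (intro linearI)
    fix x y c
    have "T (inv T x + inv T y) = x + y" "T (c *\<^sub>R inv T x) = c *\<^sub>R x"
      using surj by (simp_all add: linear_add[OF lin] linear_scale[OF lin] surj_f_inv_f)
    then show "inv T (x + y) = inv T x + inv T y" "inv T (c *\<^sub>R x) = c *\<^sub>R inv T x"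
      by (auto intro: inv_f_eq[OF inj])
  qed
  moreover have "inv T (br x y) = br (inv T x) (inv T y)" for x y
    by (rule inv_f_eq[OF inj]) (simp add: br surj_f_inv_f[OF surj])
  ultimately have "lie_automorphism br (inv T)"
    using bij by (simp add: lie_automorphism_def bij_imp_bij_inv)
  moreover have "Q x = inv T \<circ> P (inv (inv T) x) \<circ> inv (inv T)" for x
    by (rule ext) (simp add: inv_inv_eq[OF bij] PQ inj)
  ultimately show ?thesis
    unfolding isomorphic_connections_def by blast
qed

text \<open>The vector \<open>e3\<close> is the bracket of \<open>e1\<close> and \<open>e2\<close>,
  so its image is again a bracket; injectivity keeps it nonzero.\<close>

lemma heisenberg_automorphism_center:
  assumes "lie_automorphism g31 f"
  obtains t where "t \<noteq> 0" "f e3 = t *\<^sub>R e3"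
proof -
  have lin: "linear f" and inj: "inj f" and f: "\<And>x y. f (g31 x y) = g31 (f x) (f y)"
    using assms by (auto simp: lie_automorphism_def bij_def)
  have "f e3 = area (f e1) (f e2) *\<^sub>R e3"
    using f[of e1 e2] by (simp add: g31_eq area_def)
  moreover have "f e3 \<noteq> 0"
    using inj lin by (metis axis_eq_0_iff injD linear_0 zero_neq_one)
  ultimately show ?thesis
    using that by force
qed

definition acts_on_center :: "(real^3 \<Rightarrow> real^3 \<Rightarrow> real^3) \<Rightarrow> bool" where
  "acts_on_center P \<longleftrightarrow> (\<exists>x. P e3 x \<noteq> 0)"

text \<open>Separates \<open>H01\<close> from \<open>H11\<close> and \<open>H04\<close> from
  \<open>H41\<close>.\<close>

definition square_reduced where
  "square_reduced P \<longleftrightarrow> (\<forall>x::real^3. P (P x x) (P x x) = 0 \<longrightarrow> P x x = 0)"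

definition alternating where
  "alternating P \<longleftrightarrow> (\<forall>x::real^3. P x x = (0::real^3))"

text \<open>The relation \<open>(x x) x = l (x (x x) - (x x) x)\<close> with terms collected. It
  detects the parameter of \<open>H05\<close>, with \<open>H02\<close> in the role of parameter
  zero.\<close>

definition cube_ratio where
  "cube_ratio P l \<longleftrightarrow>
     (\<forall>x::real^3. (1 + l) *\<^sub>R P (P x x) x = l *\<^sub>R P x (P x x))"

text \<open>For products with values in the centre, \<open>d\<close> is the determinant of the symmetric part
  of the product, relative to the square of the bracket.\<close>

definition discriminant where
  "discriminant P d \<longleftrightarrow> (\<forall>x y a b c s. P x x = a *\<^sub>R e3 \<longrightarrow> P y y = b *\<^sub>R e3 \<longrightarrow>
     P x y + P y x = c *\<^sub>R e3 \<longrightarrow> g31 x y = s *\<^sub>R e3 \<longrightarrow> a * b - c\<^sup>2 / 4 = d * s\<^sup>2)"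

text \<open>An isomorphism \<open>f\<close> is onto, so conditions on all vectors can be tested on
  vectors \<open>f x\<close>. It multiplies \<open>e3\<close> by some nonzero \<open>t\<close>,
  hence rescales all coefficients along \<open>e3\<close> by the same factor.\<close>

lemma invariants_transfer:
  assumes "isomorphic_connections g31 P Q" and Q: "bilinear Q"
  shows "acts_on_center Q = acts_on_center P"
    and "square_reduced Q = square_reduced P"
    and "alternating Q = alternating P"
    and "cube_ratio Q l = cube_ratio P l"
    and "discriminant Q d = discriminant P d"
proof -
  obtain f where auto: "lie_automorphism g31 f" and f: "\<And>x y. f (P x y) = Q (f x) (f y)"
    using isomorphic_connectionsE[OF assms(1)] by blast
  have lin: "linear f" and inj: "inj f" and surj: "surj f"
    and br: "\<And>x y. g31 (f x) (f y) = f (g31 x y)"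
    using auto by (auto simp: lie_automorphism_def bij_def)
  obtain t where t: "t \<noteq> 0" "f e3 = t *\<^sub>R e3"
    using heisenberg_automorphism_center[OF auto] .
  have f0: "f x = 0 \<longleftrightarrow> x = 0" for x
    using lin inj by (metis injD linear_0)
  have eq: "f x = f y \<longleftrightarrow> x = y" for x y
    using inj by (auto simp: inj_def)
  have fs: "f (c *\<^sub>R x) = c *\<^sub>R f x" "f (x + y) = f x + f y" for c x y
    using lin by (simp_all add: linear_scale linear_add)
  have fz: "f x = a *\<^sub>R e3 \<longleftrightarrow> x = (a / t) *\<^sub>R e3" for x a
  proof -
    have "a *\<^sub>R e3 = f ((a / t) *\<^sub>R e3)"
      using t by (simp add: fs)
    then show ?thesis by (simp add: eq)
  qed
  have all: "(\<forall>y. R y) \<longleftrightarrow> (\<forall>x. R (f x))" for R :: "real^3 \<Rightarrow> bool"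
  proof (intro iffI allI)
    fix y assume "\<forall>x. R (f x)"
    then show "R y" using surj by (metis surjD)
  qed simp
  have "t *\<^sub>R Q e3 (f x) = f (P e3 x)" for x
    using bilinear_lmul[OF Q, of t e3 "f x"] t(2) by (simp add: f)
  then have "f (P e3 x) = 0 \<longleftrightarrow> Q e3 (f x) = 0" for x
    using t(1) by (metis scaleR_eq_0_iff)
  then show "acts_on_center Q = acts_on_center P"
    using all[of "\<lambda>x. Q e3 x = 0"] by (auto simp: acts_on_center_def f0)
  show "square_reduced Q = square_reduced P"
    using all[of "\<lambda>x. Q (Q x x) (Q x x) = 0 \<longrightarrow> Q x x = 0"]
    by (simp add: square_reduced_def flip: f add: f0)
  show "alternating Q = alternating P"
    using all[of "\<lambda>x. Q x x = 0"] by (simp add: alternating_def flip: f add: f0)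
  show "cube_ratio Q l = cube_ratio P l"
    using all[of "\<lambda>x. (1 + l) *\<^sub>R Q (Q x x) x = l *\<^sub>R Q x (Q x x)"]
    by (simp add: cube_ratio_def flip: f fs add: eq)
  \<comment> \<open>Both sides are homogeneous of degree two in \<open>a\<close>, \<open>b\<close>,
    \<open>c\<close>, \<open>s\<close>, so dividing all four by \<open>t\<close> preserves the
    equation.\<close>
  have key: "a * b - c\<^sup>2 / 4 = d * s\<^sup>2 \<longleftrightarrow>
      (a / t) * (b / t) - (c / t)\<^sup>2 / 4 = d * (s / t)\<^sup>2" for a b c s
  proof -
    have "(a / t) * (b / t) - (c / t)\<^sup>2 / 4 - d * (s / t)\<^sup>2 = (a * b - c\<^sup>2 / 4 - d * s\<^sup>2) / t\<^sup>2"
      by (simp add: power2_eq_square diff_divide_distrib)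
    then show ?thesis
      using t(1) by (metis divide_eq_0_iff right_minus_eq zero_eq_power2)
  qed
  show "discriminant Q d = discriminant P d"
  proof
    assume Q: "discriminant Q d"
    show "discriminant P d"
      unfolding discriminant_def
    proof (intro allI impI)
      fix x y a b c s
      assume "P x x = a *\<^sub>R e3" "P y y = b *\<^sub>R e3" "P x y + P y x = c *\<^sub>R e3" "g31 x y = s *\<^sub>R e3"
      then have "Q (f x) (f x) = (a * t) *\<^sub>R e3" "Q (f y) (f y) = (b * t) *\<^sub>R e3"
        "Q (f x) (f y) + Q (f y) (f x) = (c * t) *\<^sub>R e3" "g31 (f x) (f y) = (s * t) *\<^sub>R e3"
        using t(1) by (simp_all add: br flip: f fs add: fz)
      then have "a * t * (b * t) - (c * t)\<^sup>2 / 4 = d * (s * t)\<^sup>2"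
        using Q unfolding discriminant_def by blast
      then show "a * b - c\<^sup>2 / 4 = d * s\<^sup>2"
        using t(1) by (subst (asm) key) simp
    qed
  next
    assume P: "discriminant P d"
    show "discriminant Q d"
      unfolding discriminant_def
    proof (intro allI impI)
      fix x' y' a b c s
      assume *: "Q x' x' = a *\<^sub>R e3" "Q y' y' = b *\<^sub>R e3" "Q x' y' + Q y' x' = c *\<^sub>R e3"
        "g31 x' y' = s *\<^sub>R e3"
      obtain x y where "x' = f x" "y' = f y"
        using surj by (meson surjD)
      with * have "P x x = (a / t) *\<^sub>R e3" "P y y = (b / t) *\<^sub>R e3"
        "P x y + P y x = (c / t) *\<^sub>R e3" "g31 x y = (s / t) *\<^sub>R e3"
        by (simp_all add: br flip: f fs add: fz)
      then have "(a / t) * (b / t) - (c / t)\<^sup>2 / 4 = d * (s / t)\<^sup>2"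
        using P unfolding discriminant_def by blast
      then show "a * b - c\<^sup>2 / 4 = d * s\<^sup>2"
        by (rule key[THEN iffD2])
    qed
  qed
qed

section \<open>Values of the invariants on the normal forms\<close>

lemma acts_on_center_normal_form:
  "acts_on_center (normal_form h) \<longleftrightarrow> h \<in> {H04, H41}"
proof -
  have "normal_form H04 e3 e1 \<noteq> 0" "normal_form H41 e3 e2 \<noteq> 0"
    by (simp_all add: bilinear_of_table_def vec3_eq_iff)
  then have "acts_on_center (normal_form H04)" "acts_on_center (normal_form H41)"
    unfolding acts_on_center_def by blast+
  then show ?thesis
    by (cases h) (simp_all add: acts_on_center_def bilinear_of_table_def)
qed

lemma square_reduced_normal_form:
  "square_reduced (normal_form H01)" "square_reduced (normal_form H04)"
  "\<not> square_reduced (normal_form H11)" "\<not> square_reduced (normal_form H41)"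
proof -
  show "square_reduced (normal_form H01)" "square_reduced (normal_form H04)"
    by (auto simp: square_reduced_def bilinear_of_table_def vec3_eq_iff)
  let ?P = "normal_form H11" let ?Q = "normal_form H41"
  have "?P (?P e1 e1) (?P e1 e1) = 0" "?P e1 e1 \<noteq> 0"
    "?Q (?Q e1 e1) (?Q e1 e1) = 0" "?Q e1 e1 \<noteq> 0"
    by (simp_all add: bilinear_of_table_def vec3_eq_iff)
  then show "\<not> square_reduced ?P" "\<not> square_reduced ?Q"
    unfolding square_reduced_def by blast+
qed

lemma alternating_normal_form:
  "alternating (normal_form H06)" "\<not> alternating (normal_form H03)"
  "\<not> alternating (normal_form (H61 l))"
proof -
  show "alternating (normal_form H06)"
    by (auto simp: alternating_def bilinear_of_table_def vec3_eq_iff)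
  have "normal_form H03 (e1 + e2) (e1 + e2) \<noteq> 0" "normal_form (H61 l) e2 e2 \<noteq> 0"
    by (simp_all add: bilinear_of_table_def vec3_eq_iff)
  then show "\<not> alternating (normal_form H03)" "\<not> alternating (normal_form (H61 l))"
    unfolding alternating_def by blast+
qed

text \<open>A nonzero idempotent would force \<open>1 + l = l\<close>; this excludes the forms in
  which \<open>e1\<close> or \<open>e2\<close> is idempotent. In \<open>H03\<close>,
  \<open>H06\<close> and \<open>H61\<close> all triple products vanish, so every \<open>l\<close>
  qualifies. In \<open>H02\<close> and \<open>H05\<close> the vector \<open>e1\<close> pins
  \<open>l\<close> down.\<close>

lemma cube_ratio_normal_form:
  "cube_ratio (normal_form h) l \<longleftrightarrow>
    (case h of H02 \<Rightarrow> l = 0 | H05 m \<Rightarrow> l = m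
      | H03 \<Rightarrow> True | H06 \<Rightarrow> True | H61 _ \<Rightarrow> True | _ \<Rightarrow> False)"
proof -
  let ?C = "\<lambda>P x. (1 + l) *\<^sub>R P (P x x) x = l *\<^sub>R P x (P x x)"
  have "?C (normal_form H02) e1 \<longleftrightarrow> l = 0" "?C (normal_form (H05 m)) e1 \<longleftrightarrow> l = m"
    "\<not> ?C (normal_form H01) e1" "\<not> ?C (normal_form H04) e1"
    "\<not> ?C (normal_form H11) e2" "\<not> ?C (normal_form H41) e2" for m
    by (auto simp: bilinear_of_table_def vec3_eq_iff algebra_simps)
  moreover have "?C (normal_form (H05 l)) x" "l = 0 \<Longrightarrow> ?C (normal_form H02) x"
    "?C (normal_form H03) x" "?C (normal_form H06) x" "?C (normal_form (H61 m)) x" for x m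
    by (auto simp: bilinear_of_table_def vec3_eq_iff algebra_simps)
  ultimately show ?thesis
    unfolding cube_ratio_def by (cases h; simp del: normal_form.simps; blast)
qed

text \<open>The pair \<open>e1\<close>, \<open>e2\<close> has bracket \<open>e3\<close> and so
  forces the value of \<open>d\<close>. Conversely, the Gram determinant of any pair is that of
  \<open>e1\<close>, \<open>e2\<close> times the square of the determinant of the change of
  basis.\<close>

lemma discriminant_normal_form:
  "discriminant (normal_form H03) d \<longleftrightarrow> d = - 1/4"
  "discriminant (normal_form (H61 l)) d \<longleftrightarrow> d = l - 1/4"
proof -
  let ?P = "normal_form H03" let ?Q = "normal_form (H61 l)"
  have *: "?P e1 e1 = 0 *\<^sub>R e3" "?P e2 e2 = 0 *\<^sub>R e3" "?P e1 e2 + ?P e2 e1 = 1 *\<^sub>R e3"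
    "?Q e1 e1 = l *\<^sub>R e3" "?Q e2 e2 = 1 *\<^sub>R e3" "?Q e1 e2 + ?Q e2 e1 = 1 *\<^sub>R e3"
    "g31 e1 e2 = 1 *\<^sub>R e3"
    by (simp_all add: bilinear_of_table_def g31_eq area_def)
  show "discriminant ?P d \<longleftrightarrow> d = - 1/4"
  proof
    assume "discriminant ?P d"
    then have "0 * 0 - 1\<^sup>2 / 4 = d * 1\<^sup>2"
      unfolding discriminant_def using * by blast
    then show "d = - 1/4" by simp
  next
    assume "d = - 1/4"
    show "discriminant ?P d"
      unfolding discriminant_def
    proof (intro allI impI)
      fix x y :: "real^3" and a b c s
      assume "?P x x = a *\<^sub>R e3" "?P y y = b *\<^sub>R e3" "?P x y + ?P y x = c *\<^sub>R e3"
        "g31 x y = s *\<^sub>R e3"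
      then have "a = x $ 1 * x $ 2" "b = y $ 1 * y $ 2"
        "c = x $ 1 * y $ 2 + y $ 1 * x $ 2" "s = x $ 1 * y $ 2 - x $ 2 * y $ 1"
        by (simp_all add: bilinear_of_table_def vec3_eq_iff g31_eq area_def algebra_simps)
      then show "a * b - c\<^sup>2 / 4 = d * s\<^sup>2"
        by (simp add: \<open>d = - 1/4\<close> power2_eq_square) (simp add: field_simps)
    qed
  qed
  show "discriminant ?Q d \<longleftrightarrow> d = l - 1/4"
  proof
    assume "discriminant ?Q d"
    then have "l * 1 - 1\<^sup>2 / 4 = d * 1\<^sup>2"
      unfolding discriminant_def using * by blast
    then show "d = l - 1/4" by simp
  next
    assume "d = l - 1/4"
    show "discriminant ?Q d"
      unfolding discriminant_def
    proof (intro allI impI)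
      fix x y :: "real^3" and a b c s
      assume "?Q x x = a *\<^sub>R e3" "?Q y y = b *\<^sub>R e3" "?Q x y + ?Q y x = c *\<^sub>R e3"
        "g31 x y = s *\<^sub>R e3"
      then have "a = x $ 1 * x $ 1 * l + x $ 1 * x $ 2 + x $ 2 * x $ 2"
        "b = y $ 1 * y $ 1 * l + y $ 1 * y $ 2 + y $ 2 * y $ 2"
        "c = 2 * x $ 1 * y $ 1 * l + x $ 1 * y $ 2 + y $ 1 * x $ 2 + 2 * x $ 2 * y $ 2"
        "s = x $ 1 * y $ 2 - x $ 2 * y $ 1"
        by (simp_all add: bilinear_of_table_def vec3_eq_iff g31_eq area_def algebra_simps)
      then show "a * b - c\<^sup>2 / 4 = d * s\<^sup>2"
        by (simp add: \<open>d = l - 1/4\<close> power2_eq_square) (simp add: field_simps)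
    qed
  qed
qed

lemma normal_form_unique:
  assumes "isomorphic_connections g31 P (normal_form h)"
    and "isomorphic_connections g31 P (normal_form k)"
    and "admissible h" "admissible k"
  shows "h = k"
proof -
  note inv = invariants_transfer[OF assms(1) bilinear_normal_form]
    invariants_transfer[OF assms(2) bilinear_normal_form]
  have inv': "acts_on_center (normal_form h) = acts_on_center (normal_form k)"
    "square_reduced (normal_form h) = square_reduced (normal_form k)"
    "alternating (normal_form h) = alternating (normal_form k)"
    and c: "\<And>l. cube_ratio (normal_form h) l = cube_ratio (normal_form k) l"
    and d: "\<And>d. discriminant (normal_form h) d = discriminant (normal_form k) d"
    by (simp_all add: inv)
  show ?thesis
    \<comment> \<open>Ratio 0 separates \<open>H02\<close> from \<open>H05\<close>, ratio 1
      separates \<open>H02\<close> from the forms with central products, and the parameters of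
      \<open>h\<close> and \<open>k\<close> themselves settle the other comparisons with
      \<open>H05\<close>. The discriminant -1/4 belongs to \<open>H03\<close>. The default 0 only
      fills the cases without a parameter.\<close>
    using assms(3,4) inv' c[of 0] c[of 1] c[of "case h of H05 a \<Rightarrow> a | _ \<Rightarrow> 0"]
      c[of "case k of H05 a \<Rightarrow> a | _ \<Rightarrow> 0"] d[of "-1/4"]
      d[of "case h of H61 a \<Rightarrow> a - 1/4 | _ \<Rightarrow> 0"]
    by (cases h; cases k)
      (simp_all add: acts_on_center_normal_form square_reduced_normal_form
        alternating_normal_form cube_ratio_normal_form discriminant_normal_form
        del: normal_form.simps)
qed

section \<open>Central commutators\<close>

text \<open>By Newton's identities the three traces force the characteristic polynomial
  \<open>X^3\<close>; what remains is Cayley-Hamilton written out in entries.\<close>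

lemma cayley_hamilton_nilpotent:
  fixes M :: "real^3^3"
  assumes "trace M = 0" "trace (M ** M) = 0" "trace (M ** M ** M) = 0"
  shows "M ** M ** M = 0"
proof -
  have 1: "M$1$1 + M$2$2 + M$3$3 = 0"
    using assms(1) by (simp add: trace_def sum_3)
  have 2: "M$1$1*M$1$1 + M$2$2*M$2$2 + M$3$3*M$3$3
      + 2 * (M$1$2*M$2$1 + M$1$3*M$3$1 + M$2$3*M$3$2) = 0"
    using assms(2) by (simp add: trace_def matrix_matrix_mult_def sum_3 algebra_simps)
  have 3: "M$3$3 = - M$1$1 - M$2$2"
    using 1 by simp
  \<comment> \<open>Minus the second coefficient of the characteristic polynomial, with
    \<open>M$3$3\<close> eliminated by the trace.\<close>
  have 4: "M$1$1*M$1$1 + M$2$2*M$2$2 + M$1$1*M$2$2 + M$1$2*M$2$1 + M$1$3*M$3$1 + M$2$3*M$3$2 = 0"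
    using 2 unfolding 3 by (simp add: algebra_simps)
  have 5: "det M = 0"
    using assms(3) 4
    by (simp add: det_3 trace_def matrix_matrix_mult_def sum_3 3) algebra
  have 6: "M$1$1*M$2$2*M$3$3 + M$1$2*M$2$3*M$3$1 + M$1$3*M$2$1*M$3$2
     - M$1$1*M$2$3*M$3$2 - M$1$2*M$2$1*M$3$3 - M$1$3*M$2$2*M$3$1 = 0"
    using 5 by (simp add: det_3)
  show ?thesis
    using 1 4 6
    by (simp add: vec_eq_iff forall_3 matrix_matrix_mult_def sum_3) (intro conjI; algebra)
qed

text \<open>Cyclicity of the trace makes \<open>M\<close> nilpotent. If its square were nonzero,
  \<open>M\<close> would have a cyclic vector, so everything commuting with \<open>M\<close> would
  be a polynomial in \<open>M\<close>; then \<open>A\<close> and \<open>B\<close> would commute and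
  \<open>M\<close> would vanish.\<close>

lemma central_commutator_square_zero:
  fixes A B :: "real^3^3"
  defines "M \<equiv> A ** B - B ** A"
  assumes A: "M ** A = A ** M" and B: "M ** B = B ** M"
  shows "M ** M = 0"
proof -
  have tr: "trace (X ** M) = 0" if "X ** A = A ** X" for X
  proof -
    have "trace (X ** (A ** B)) = trace (A ** (X ** B))"
      by (simp add: matrix_mul_assoc that)
    also have "\<dots> = trace (X ** (B ** A))"
      by (subst trace_mul_sym) (simp add: matrix_mul_assoc)
    finally have "trace (X ** (A ** B)) = trace (X ** (B ** A))" .
    moreover have "A ** B = M + B ** A"
      by (simp add: M_def)
    ultimately show ?thesis
      by (simp add: matrix_add_ldistrib trace_add)
  qed
  have "trace (mat 1 ** M) = 0" "trace (M ** M) = 0" "trace (M ** M ** M) = 0"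
    using tr[of "mat 1"] tr[OF A] tr[of "M ** M"] A by (simp_all, metis matrix_mul_assoc)
  then have M3: "M ** M ** M = 0"
    by (intro cayley_hamilton_nilpotent) simp_all
  show ?thesis
  proof (rule ccontr)
    assume "M ** M \<noteq> 0"
    then obtain v where "(M ** M) *v v \<noteq> 0"
      by (metis matrix_eq matrix_vector_mult_0)
    then have v2: "M *v (M *v v) \<noteq> 0"
      by (simp add: matrix_vector_mul_assoc)
    have v3: "M *v (M *v (M *v v)) = 0"
      using M3 by (simp add: matrix_vector_mul_assoc matrix_mul_assoc)
    define v1 where "v1 = M *v v"
    define v2 where "v2 = M *v v1"
    have ne: "v2 \<noteq> 0" and Mv: "M *v v = v1" "M *v v1 = v2" "M *v v2 = 0"
      using v2 v3 by (simp_all add: v1_def v2_def)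
    \<comment> \<open>Applying \<open>M\<close> twice isolates \<open>a\<close>, applying it once
      then isolates \<open>b\<close>.\<close>
    have comb: "a = 0 \<and> b = 0 \<and> c = 0" if "a *\<^sub>R v + b *\<^sub>R v1 + c *\<^sub>R v2 = 0" for a b c
    proof -
      have M1: "M *v (M *v (a *\<^sub>R v + b *\<^sub>R v1 + c *\<^sub>R v2)) = a *\<^sub>R v2"
        and M2: "M *v (a *\<^sub>R v + b *\<^sub>R v1 + c *\<^sub>R v2) = a *\<^sub>R v1 + b *\<^sub>R v2"
        by (simp_all add: matrix_vector_right_distrib matrix_vector_mult_scaleR Mv)
      have "a = 0"
        using M1 that ne by simp
      moreover from this have "b = 0"
        using M2 that ne by simp
      ultimately show ?thesis
        using that ne by simp
    qed
    have dist: "v \<noteq> v1" "v \<noteq> v2" "v1 \<noteq> v2"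
      using comb[of 1 "-1" 0] comb[of 1 0 "-1"] comb[of 0 1 "-1"] by auto
    have "v2 \<notin> span {}" "v1 \<notin> span {v2}" "v \<notin> span {v1, v2}"
    proof -
      show "v2 \<notin> span {}"
        using ne by simp
      have False if "v1 = k *\<^sub>R v2" for k
        using comb[of 0 1 "- k"] that by simp
      then show "v1 \<notin> span {v2}"
        by (auto simp: span_breakdown_eq)
      have False if "v = k *\<^sub>R v1 + l *\<^sub>R v2" for k l
        using comb[of 1 "- k" "- l"] that by simp
      then show "v \<notin> span {v1, v2}"
        by (auto simp: span_breakdown_eq algebra_simps)
    qed
    then have "independent {v, v1, v2}"
      by (intro independent_insertI) (simp_all add: independent_empty)
    then have span: "UNIV \<subseteq> span {v, v1, v2}"
      using dist by (subst (asm) card_eq_dim[of _ UNIV]) simp_all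
    have ex: "\<exists>a b c. x = a *\<^sub>R v + b *\<^sub>R v1 + c *\<^sub>R v2" for x
    proof -
      have "x \<in> span {v, v1, v2}"
        using span by blast
      then obtain a b c where "x - a *\<^sub>R v - b *\<^sub>R v1 = c *\<^sub>R v2"
        by (auto simp: span_breakdown_eq)
      then show ?thesis
        by (metis diff_diff_add diff_eq_eq add.commute)
    qed
    obtain a b c where Av: "A *v v = a *\<^sub>R v + b *\<^sub>R v1 + c *\<^sub>R v2"
      using ex by blast
    obtain a' b' c' where Bv: "B *v v = a' *\<^sub>R v + b' *\<^sub>R v1 + c' *\<^sub>R v2"
      using ex by blast
    \<comment> \<open>Commuting with \<open>M\<close> determines \<open>A\<close> and
      \<open>B\<close> on the whole basis from their values at the cyclic vector
      \<open>v\<close>.\<close>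
    have comm: "A *v (M *v x) = M *v (A *v x)" "B *v (M *v x) = M *v (B *v x)" for x
      by (simp_all add: matrix_vector_mul_assoc A B)
    note lin = matrix_vector_right_distrib matrix_vector_mult_scaleR Mv
    have "A *v v1 = a *\<^sub>R v1 + b *\<^sub>R v2" "B *v v1 = a' *\<^sub>R v1 + b' *\<^sub>R v2"
      using comm[of v] by (simp_all add: Mv Av Bv lin)
    moreover from this have "A *v v2 = a *\<^sub>R v2" "B *v v2 = a' *\<^sub>R v2"
      using comm[of v1] by (simp_all add: Mv lin)
    ultimately have "A *v (B *v v) = B *v (A *v v)"
      by (simp add: Av Bv lin algebra_simps)
    then have "v1 = 0"
      by (simp add: v1_def M_def matrix_vector_mult_diff_rdistrib flip: matrix_vector_mul_assoc)
    with ne Mv show False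
      by simp
  qed
qed

text \<open>The image lies in the kernel, so in dimension three the rank is at most one. The proof
  obtains this from the vanishing of all two-by-two minors.\<close>

lemma square_zero_rank_le_one:
  fixes M :: "real^3^3"
  assumes sq: "M ** M = 0" and tr: "trace M = 0"
  obtains f v where "\<And>x. M *v x = f x *\<^sub>R v"
proof -
  have t: "M$3$3 = - M$1$1 - M$2$2"
    using tr by (simp add: trace_def sum_3)
  have sq': "M$i$1 * M$1$j + M$i$2 * M$2$j + M$i$3 * M$3$j = 0" for i j
    using sq by (simp add: vec_eq_iff matrix_matrix_mult_def sum_3)
  have minors: "M$i$j * M$k$l = M$i$l * M$k$j" for i j k l
  proof -
    note e = sq'[of 1 1] sq'[of 1 2] sq'[of 1 3] sq'[of 2 1] sq'[of 2 2] sq'[of 2 3]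
      sq'[of 3 1] sq'[of 3 2] sq'[of 3 3]
    have "M$1$1 * M$2$2 = M$1$2 * M$2$1" "M$1$1 * M$2$3 = M$1$3 * M$2$1" "M$1$2 * M$2$3 = M$1$3 * M$2$2"
     "M$1$1 * M$3$2 = M$1$2 * M$3$1" "M$1$1 * M$3$3 = M$1$3 * M$3$1" "M$1$2 * M$3$3 = M$1$3 * M$3$2"
     "M$2$1 * M$3$2 = M$2$2 * M$3$1" "M$2$1 * M$3$3 = M$2$3 * M$3$1" "M$2$2 * M$3$3 = M$2$3 * M$3$2"
      using e unfolding t by algebra+
    then have "\<forall>i j k l. M$i$j * M$k$l = M$i$l * M$k$j"
      by (simp add: forall_3 mult.commute)
    then show ?thesis
      by blast
  qed
  show ?thesis
  proof (cases "M = 0")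
    case True
    then show ?thesis
      using that[of "\<lambda>_. 0" 0] by simp
  next
    case False
    then obtain p q where pq: "M$p$q \<noteq> 0"
      by (metis vec_eq_iff zero_index)
    \<comment> \<open>With vanishing minors, any column through a nonzero entry spans the
      image.\<close>
    have "M *v x = ((M *v x) $ p / M$p$q) *\<^sub>R column q M" for x
    proof -
      have "(M *v x) $ k * M$p$q = (M *v x) $ p * M$k$q" for k
      proof -
        have "M$k$j * x$j * M$p$q = M$p$j * x$j * M$k$q" for j
          using minors[of k j p q] by (metis mult.commute mult.left_commute)
        then show ?thesis
          unfolding matrix_vector_mult_def by (simp only: vec_lambda_beta sum_distrib_right)
      qed
      then show ?thesis
        using pq by (simp add: vec_eq_iff column_def field_simps)
    qed
    then show ?thesis
      by (rule that)
  qed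
qed

section \<open>Adapted frames\<close>

text \<open>Sends \<open>e1\<close>, \<open>e2\<close> to \<open>u\<close>, \<open>v\<close>. The
  third coefficient sends \<open>e3\<close> to the bracket of \<open>u\<close> and \<open>v\<close>,
  as a Lie algebra homomorphism must.\<close>

definition frame :: "real^3 \<Rightarrow> real^3 \<Rightarrow> real^3 \<Rightarrow> real^3" where
  "frame u v x = x $ 1 *\<^sub>R u + x $ 2 *\<^sub>R v + (area u v * x $ 3) *\<^sub>R e3"

lemma linear_frame: "linear (frame u v)"
  by (intro linearI) (simp_all add: frame_def algebra_simps)

lemma area_frame: "area (frame u v x) (frame u v y) = area u v * area x y"
  by (simp add: frame_def area_commute[of v u]) (simp add: area_def algebra_simps)

lemma lie_automorphism_frame:
  assumes "area u v \<noteq> 0"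
  shows "lie_automorphism g31 (frame u v)"
proof -
  have "inj (frame u v)"
  proof (subst linear_injective_0[OF linear_frame], intro allI impI)
    fix x assume x: "frame u v x = 0"
    have "area (frame u v x) v = area u v * x $ 1" "area u (frame u v x) = area u v * x $ 2"
      by (simp_all add: frame_def)
    then have "x $ 1 = 0" "x $ 2 = 0"
      using x assms by simp_all
    with x assms show "x = 0"
      by (simp add: frame_def vec3_eq_iff)
  qed
  then have "bij (frame u v)"
    by (simp add: bij_def linear_injective_imp_surjective[OF linear_frame])
  moreover have "frame u v (g31 x y) = g31 (frame u v x) (frame u v y)" for x y
    by (simp add: g31_eq area_frame) (simp add: frame_def)
  ultimately show ?thesis
    by (simp add: lie_automorphism_def linear_frame)
qed

lemma basis_expansion: "x = x $ 1 *\<^sub>R e1 + x $ 2 *\<^sub>R e2 + x $ 3 *\<^sub>R e3"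
  by (simp add: vec3_eq_iff)

lemma bilinear_simps:
  assumes "bilinear P"
  shows "P (x + y) w = P x w + P y w" "P w (x + y) = P w x + P w y"
    "P (x - y) w = P x w - P y w" "P w (x - y) = P w x - P w y"
    "P (c *\<^sub>R x) w = c *\<^sub>R P x w" "P w (c *\<^sub>R x) = c *\<^sub>R P w x"
    "P (- x) w = - P x w" "P w (- x) = - P w x" "P 0 w = 0" "P w 0 = 0"
  using assms
  by (simp_all add: bilinear_ladd bilinear_radd bilinear_lsub bilinear_rsub bilinear_lmul
      bilinear_rmul bilinear_lneg bilinear_rneg bilinear_lzero bilinear_rzero)

lemma isomorphic_frame:
  assumes P: "bilinear P" and Q: "bilinear Q" and uv: "area u v \<noteq> 0"
    and table: "\<And>i j. P (frame u v (axis i 1)) (frame u v (axis j 1)) = frame u v (Q (axis i 1) (axis j 1))"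
  shows "isomorphic_connections g31 P Q"
proof (rule isomorphic_connectionsI[OF lie_automorphism_frame[OF uv]])
  fix x y
  note lin = linear_add[OF linear_frame] linear_scale[OF linear_frame]
  show "P (frame u v x) (frame u v y) = frame u v (Q x y)"
    by (subst (1 2) basis_expansion[of x], subst (1 2) basis_expansion[of y])
      (simp only: lin table bilinear_simps[OF P] bilinear_simps[OF Q])
qed

lemma area_0_iff: "(\<forall>y. area x y = 0) \<longleftrightarrow> x = x $ 3 *\<^sub>R e3"
proof
  assume "\<forall>y. area x y = 0"
  then have "area x e1 = 0" "area x e2 = 0"
    by blast+
  then show "x = x $ 3 *\<^sub>R e3"
    by (simp add: vec3_eq_iff area_def)
next
  assume "x = x $ 3 *\<^sub>R e3"
  then show "\<forall>y. area x y = 0"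
    by (metis area_simps(5,12) mult_zero_right)
qed

text \<open>Cramer's rule in the plane modulo \<open>e3\<close>.\<close>

lemma area_expansion:
  assumes "area u v = 1"
  obtains r where "x = area x v *\<^sub>R u + area u x *\<^sub>R v + r *\<^sub>R e3"
proof -
  have "u $ 1 * v $ 2 - u $ 2 * v $ 1 = 1"
    using assms by (simp add: area_def)
  then have "x = area x v *\<^sub>R u + area u x *\<^sub>R v
      + (x $ 3 - area x v * u $ 3 - area u x * v $ 3) *\<^sub>R e3"
    by (simp add: vec3_eq_iff area_def) algebra
  then show ?thesis
    by (rule that)
qed

section \<open>Flat torsion-free connections on the Heisenberg algebra\<close>

locale flat_heisenberg =
  fixes P :: "real^3 \<Rightarrow> real^3 \<Rightarrow> real^3"
  assumes flat_lie: "flat_lie_algebra g31 P"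
begin

lemma bilinear_P: "bilinear P"
  using flat_lie by (simp add: flat_lie_algebra_def)

lemmas bil = bilinear_simps[OF bilinear_P]

lemma torsion: "P y x = P x y - area x y *\<^sub>R e3"
proof -
  have "P x y - P y x = area x y *\<^sub>R e3"
    using flat_lie by (simp add: flat_lie_algebra_def torsion_free_def g31_eq)
  then show ?thesis
    by (simp add: algebra_simps)
qed

lemma flatness: "P x (P y w) = P y (P x w) + area x y *\<^sub>R P e3 w"
proof -
  have "P x (P y w) - P y (P x w) - P (area x y *\<^sub>R e3) w = 0"
    using flat_lie unfolding flat_lie_algebra_def flat_def g31_eq by blast
  then show ?thesis
    by (simp add: bil algebra_simps)
qed

lemma center_right: "P x e3 = P e3 x"
  using torsion[of e3 x] by simp

lemma center_left_commute: "P x (P e3 w) = P e3 (P x w)"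
  using flatness[of x e3 w] by simp

text \<open>Torsion-freeness recovers the product of \<open>v\<close> and \<open>u\<close> and the
  right multiplications by \<open>e3\<close>, on both sides because the normal form is flat and
  torsion-free too. The factor \<open>area u v\<close> appears because the frame sends
  \<open>e3\<close> to that multiple of itself.\<close>

lemma isomorphic_normal_formI:
  assumes uv: "area u v \<noteq> 0"
    and table: "P u u = frame u v (normal_form h e1 e1)" "P u v = frame u v (normal_form h e1 e2)"
      "P v v = frame u v (normal_form h e2 e2)"
    and center: "area u v *\<^sub>R P e3 u = frame u v (normal_form h e3 e1)"
      "area u v *\<^sub>R P e3 v = frame u v (normal_form h e3 e2)" "P e3 e3 = 0" "normal_form h e3 e3 = 0"
  shows "isomorphic_connections g31 P (normal_form h)"
proof (rule isomorphic_frame[OF bilinear_P bilinear_normal_form uv])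
  interpret Q: flat_heisenberg "normal_form h"
    by unfold_locales (rule flat_lie_algebra_normal_form)
  have fr: "frame u v e1 = u" "frame u v e2 = v" "frame u v e3 = area u v *\<^sub>R e3" "frame u v 0 = 0"
    by (simp_all add: frame_def)
  have "P v u = frame u v (normal_form h e2 e1)"
    by (simp add: torsion[of v u] Q.torsion[of e2 e1] table linear_diff[OF linear_frame] fr)
      (simp add: area_def linear_scale[OF linear_frame] fr)
  then have "\<forall>i j. P (frame u v (axis i 1)) (frame u v (axis j 1)) = frame u v (normal_form h (axis i 1) (axis j 1))"
    by (simp add: forall_3 fr bil table center center_right[of u] center_right[of v]
        Q.center_right[of e1] Q.center_right[of e2] del: normal_form.simps)
  then show "P (frame u v (axis i 1)) (frame u v (axis j 1)) = frame u v (normal_form h (axis i 1) (axis j 1))" for i j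
    by blast
qed

section \<open>The action of the centre\<close>

lemma center_action_rank_le_one:
  obtains f v where "\<And>x. P e3 x = f x *\<^sub>R v" "\<And>x. P e3 (P e3 x) = 0"
proof -
  define L where "L x = matrix (P x)" for x
  have L: "L x *v y = P x y" for x y
    using bilinear_P by (simp add: L_def bilinear_def matrix_works)
  have M: "L e3 = L e1 ** L e2 - L e2 ** L e1"
    using flatness[of e1 e2]
    by (simp add: matrix_eq matrix_vector_mult_diff_rdistrib L area_def flip: matrix_vector_mul_assoc)
  have comm: "L e3 ** L x = L x ** L e3" for x
    by (simp add: matrix_eq L center_left_commute flip: matrix_vector_mul_assoc)
  have sq: "L e3 ** L e3 = 0"
    using central_commutator_square_zero[of "L e1" "L e2"] comm M by simp
  have "trace (L e3) = 0"
    by (simp add: M trace_sub trace_mul_sym[of "L e1"])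
  then obtain f v where "\<And>x. L e3 *v x = f x *\<^sub>R v"
    using square_zero_rank_le_one[OF sq] by blast
  moreover have "P e3 (P e3 x) = 0" for x
    by (metis L matrix_vector_mul_assoc matrix_vector_mult_0 sq)
  ultimately show ?thesis
    using that by (simp add: L)
qed

lemma center_action_in_center:
  obtains f where "linear f" "\<And>x. P e3 x = f x *\<^sub>R e3" "f e3 = 0" "\<And>x y. f (P x y) = f x * f y"
proof -
  obtain f v where N: "\<And>x. P e3 x = f x *\<^sub>R v" and NN: "\<And>x. P e3 (P e3 x) = 0"
    using center_action_rank_le_one by blast
  have "\<exists>k. v = k *\<^sub>R e3" if u: "P e3 u \<noteq> 0" for u
  proof -
    have v0: "v \<noteq> 0" and fu: "f u \<noteq> 0"
      using u N by auto
    have flin: "f (x + y) = f x + f y" "f (x - y) = f x - f y" "f (a *\<^sub>R x) = a * f x" for x y a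
      using bil(2)[of e3 x y] bil(4)[of e3 x y] bil(6)[of e3 a x] v0
      by (simp_all add: N flip: scaleR_add_left scaleR_diff_left)
    \<comment> \<open>Left multiplication by \<open>e3\<close> has image spanned by \<open>v\<close>
      and commutes with all left multiplications, so \<open>v\<close> is a common eigenvector;
      \<open>c x\<close> is the eigenvalue.\<close>
    define c where "c x = f (P x u) / f u" for x
    have Pv: "P x v = c x *\<^sub>R v" for x
    proof -
      have "f u *\<^sub>R P x v = f (P x u) *\<^sub>R v"
        using center_left_commute[of x u] by (simp add: N bil)
      then have "(1 / f u) *\<^sub>R f u *\<^sub>R P x v = (1 / f u) *\<^sub>R f (P x u) *\<^sub>R v"
        by simp
      then show ?thesis
        using fu by (simp add: c_def)
    qed
    have fP: "f (P x y) = c x * f y" for x y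
      using center_left_commute[of x y] v0 by (simp add: N bil Pv mult.commute)
    have fv: "f v = 0"
      using NN[of u] v0 fu by (simp add: N bil)
    have vP: "P v x = c x *\<^sub>R v + area v x *\<^sub>R e3" for x
      using torsion[of v x] by (simp add: Pv area_commute[of x v])
    \<comment> \<open>Two evaluations of \<open>f (P v x)\<close>, one by \<open>fP\<close> and one
      by \<open>vP\<close>.\<close>
    have fc: "f x * c v = area v x * f e3" for x
      using fP[of v x] by (simp add: vP flin fv mult.commute)
    have "\<forall>x. area v x = 0"
    proof (cases "f e3 = 0")
      case False
      then have "c v = 0"
        using fc[of e3] by simp
      then show ?thesis
        using fc False by simp
    next
      case e3: True
      \<comment> \<open>The products \<open>x y\<close> and \<open>y x\<close> differ by a multiple
        of \<open>e3\<close>, where \<open>f\<close> now vanishes; hence \<open>c\<close> is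
        proportional to \<open>f\<close>.\<close>
      then have fsym: "c x * f y = c y * f x" for x y
        using fP[of x y] fP[of y x] by (simp add: torsion[of y x] flin)
      define s where "s = area v u"
      have "c (P u u) * f u = c u * c u * f u"
        using fsym[of "P u u" u] by (simp add: fP)
      then have cc: "c (P u u) = c u * c u"
        using fu by simp
      have *: "(c u * c u + s * f u) *\<^sub>R v =
          (c u * c u - s * f u) *\<^sub>R v + area v (P u u) *\<^sub>R e3"
        using flatness[of u v u]
        by (simp add: vP bil Pv center_right[of u] N cc area_commute[of u v] s_def algebra_simps)
      have eq: "(2 * s * f u) *\<^sub>R v = area v (P u u) *\<^sub>R e3"
      proof -
        have "(2 * s * f u) *\<^sub>R v = (c u * c u + s * f u) *\<^sub>R v - (c u * c u - s * f u) *\<^sub>R v"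
          by (simp flip: scaleR_diff_left)
        then show ?thesis
          unfolding * by simp
      qed
      show ?thesis
      proof (rule ccontr)
        assume ne: "\<not> (\<forall>x. area v x = 0)"
        \<comment> \<open>Pairing with \<open>x\<close> under \<open>area\<close> removes the
          multiple of \<open>e3\<close>.\<close>
        have "2 * s * f u * area v x = 0" for x
          using arg_cong[OF eq, of "\<lambda>y. area y x"] by simp
        then have "s = 0"
          using ne fu by fastforce
        obtain y where "area v y \<noteq> 0"
          using ne by blast
        define w where "w = (1 / area v y) *\<^sub>R y"
        have "area v w = 1"
          using \<open>area v y \<noteq> 0\<close> by (simp add: w_def)
        \<comment> \<open>As \<open>s = 0\<close>, this puts \<open>u\<close> in the span of
          \<open>v\<close> and \<open>e3\<close>, on which \<open>f\<close> vanishes.\<close>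
        then obtain r where u_eq: "u = area u w *\<^sub>R v + area v u *\<^sub>R w + r *\<^sub>R e3"
          using area_expansion[of v w u] by blast
        have "f u = 0"
          using arg_cong[of _ _ f, OF u_eq] \<open>s = 0\<close> by (simp add: s_def[symmetric] flin e3 fv)
        with fu show False
          by simp
      qed
    qed
    then show ?thesis
      using v0 area_0_iff[of v] by (metis scaleR_zero_left)
  qed
  then have "\<exists>k. \<forall>x. P e3 x = (f x * k) *\<^sub>R e3"
  proof (cases "\<forall>x. P e3 x = 0")
    case True
    then show ?thesis
      by (intro exI[of _ 0]) simp
  next
    case False
    then obtain k where "v = k *\<^sub>R e3"
      using \<open>\<And>u. P e3 u \<noteq> 0 \<Longrightarrow> \<exists>k. v = k *\<^sub>R e3\<close> by blast
    then show ?thesis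
      by (intro exI[of _ k]) (simp add: N)
  qed
  then obtain k where k: "\<forall>x. P e3 x = (f x * k) *\<^sub>R e3"
    by blast
  define g where "g x = f x * k" for x
  have g: "P e3 x = g x *\<^sub>R e3" for x
    using k by (simp add: g_def)
  have "linear g"
    using bil(2)[of e3] bil(6)[of e3] by (intro linearI) (simp_all add: g flip: scaleR_add_left)
  moreover have "g e3 = 0"
    using NN[of e3] by (simp add: g bil)
  moreover have "g (P x y) = g x * g y" for x y
    using center_left_commute[of x y] by (simp add: g bil center_right[of x] mult.commute)
  ultimately show ?thesis
    using that g by blast
qed

section \<open>Normal forms when the centre acts nontrivially\<close>

lemma normal_form_center_acts:
  assumes f: "linear f" "\<And>x. P e3 x = f x *\<^sub>R e3" "f e3 = 0" "\<And>x y. f (P x y) = f x * f y"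
    and u0: "f u0 \<noteq> 0"
  shows "\<exists>h. admissible h \<and> isomorphic_connections g31 P (normal_form h)"
proof -
  note flin = linear_add[OF f(1)] linear_diff[OF f(1)] linear_scale[OF f(1)]
  define u where "u = (1 / f u0) *\<^sub>R u0"
  have fu: "f u = 1"
    using u0 by (simp add: u_def flin)
  have "u \<noteq> u $ 3 *\<^sub>R e3"
    using fu f(3) flin(3)[of "u $ 3" e3] by auto
  then have "\<not> (\<forall>y. area u y = 0)"
    by (simp only: area_0_iff not_False_eq_True)
  then obtain w0 where w0: "area u w0 \<noteq> 0"
    by blast
  define w where "w = (1 / area u w0) *\<^sub>R (w0 - f w0 *\<^sub>R u)"
  have fw: "f w = 0" and uw: "area u w = 1"
    using w0 by (simp_all add: w_def flin fu)
  have wu: "area w u = - 1"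
    by (simp add: area_commute[of w u] uw)
  have expand: "\<exists>a b. x = f x *\<^sub>R u + a *\<^sub>R w + b *\<^sub>R e3" for x
  proof -
    obtain r where r: "x = area x w *\<^sub>R u + area u x *\<^sub>R w + r *\<^sub>R e3"
      using area_expansion[OF uw] .
    have "f x = area x w"
      using arg_cong[of _ _ f, OF r] by (simp add: flin fu fw f(3))
    with r show ?thesis
      by metis
  qed
  have coeff: "a = a' \<and> b = b'" if "a *\<^sub>R w + b *\<^sub>R e3 = a' *\<^sub>R w + b' *\<^sub>R e3" for a b a' b'
  proof -
    have "a = a'"
      using arg_cong[OF that, of "area u"] by (simp add: uw)
    with that show ?thesis
      by simp
  qed
  obtain p q where uu: "P u u = u + p *\<^sub>R w + q *\<^sub>R e3"
    using expand[of "P u u"] by (auto simp: f(4) fu)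
  obtain a b where uw': "P u w = a *\<^sub>R w + b *\<^sub>R e3"
    using expand[of "P u w"] by (auto simp: f(4) fw)
  obtain c d where ww: "P w w = c *\<^sub>R w + d *\<^sub>R e3"
    using expand[of "P w w"] by (auto simp: f(4) fw)
  have wu': "P w u = a *\<^sub>R w + (b - 1) *\<^sub>R e3"
    using torsion[of w u] by (simp add: uw uw' algebra_simps)
  have ze: "P u e3 = e3" "P w e3 = 0" "P e3 u = e3" "P e3 w = 0" "P e3 e3 = 0"
    using f(3) fu fw by (simp_all add: center_right[of u] center_right[of w] f(2))
  have "(a * a) *\<^sub>R w + (a * b + (b - 1)) *\<^sub>R e3
      = (a + p * c) *\<^sub>R w + ((b - 1) + p * d + 1) *\<^sub>R e3"
    using flatness[of u w u] by (simp add: uu uw' ww wu' uw ze bil algebra_simps)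
  then have 1: "a * a = a + p * c" "a * b + (b - 1) = (b - 1) + p * d + 1"
    using coeff by blast+
  have "(c * a) *\<^sub>R w + (c * b + d) *\<^sub>R e3 = (a * c) *\<^sub>R w + (a * d) *\<^sub>R e3"
    using flatness[of u w w] by (simp add: uu uw' ww wu' uw ze bil algebra_simps)
  then have 2: "c * b + d = a * d"
    using coeff by blast
  \<comment> \<open>Since \<open>1 = a b - p d\<close>, one has
    \<open>c = a (c b) - (p c) d\<close>; both terms equal \<open>a (a - 1) d\<close>.\<close>
  have "c = 0"
    using 1 2 by algebra
  then have a: "a = 1"
    using 1 2 by (cases "a = 0") auto
  then have b: "b = 1 + p * d"
    using 1 by simp
  \<comment> \<open>A correction of \<open>u\<close> inside the kernel of \<open>f\<close> that
    makes it idempotent.\<close>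
  define u' where "u' = u - p *\<^sub>R w + (p + p * p * d - q) *\<^sub>R e3"
  have prods: "P u' u' = u'" "P u' w = w + e3" "P w u' = w" "P w w = d *\<^sub>R e3"
    "P e3 u' = e3"
    by (simp_all add: u'_def bil uu uw' wu' ww ze a b \<open>c = 0\<close> algebra_simps)
  have area: "area u' w = 1" "area w u' = - 1"
    by (simp_all add: u'_def uw wu)
  show ?thesis
  proof (cases "d = 0")
    case True
    then have "isomorphic_connections g31 P (normal_form H04)"
      by (intro isomorphic_normal_formI[of u' w])
        (simp_all add: area prods ze frame_def bilinear_of_table_def)
    then show ?thesis
      by (intro exI[of _ H04]) simp
  next
    case False
    \<comment> \<open>The scale makes the square of \<open>?w\<close> equal to its bracket with
      \<open>u'\<close>.\<close>
    let ?w = "(- 1 / d) *\<^sub>R w"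
    have "isomorphic_connections g31 P (normal_form H41)"
      using False by (intro isomorphic_normal_formI[of ?w u'])
        (simp_all add: area prods ze frame_def bilinear_of_table_def bil algebra_simps)
    then show ?thesis
      by (intro exI[of _ H41]) simp
  qed
qed

section \<open>Normal forms when the centre acts trivially\<close>

lemma normal_form_center_trivial_generic:
  assumes z: "\<And>x. P e3 x = 0" and x: "area x (P x x) \<noteq> 0"
  shows "\<exists>h. admissible h \<and> isomorphic_connections g31 P (normal_form h)"
proof -
  have z': "P x e3 = 0" for x
    by (simp add: center_right z)
  define y where "y = P x x"
  define s where "s = area x y"
  have s: "s \<noteq> 0"
    using x by (simp add: s_def y_def)
  have "area x ((1 / s) *\<^sub>R y) = 1"
    using s by (simp add: s_def)
  from area_expansion[OF this] obtain c
    where "P x y = area (P x y) ((1 / s) *\<^sub>R y) *\<^sub>R x + area x (P x y) *\<^sub>R (1 / s) *\<^sub>R y + c *\<^sub>R e3" .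
  then obtain a b where xy: "P x y = a *\<^sub>R x + b *\<^sub>R y + c *\<^sub>R e3"
    unfolding scaleR_scaleR by blast
  have yx: "P y x = P x y - s *\<^sub>R e3"
    by (simp add: torsion[of y x] s_def)
  have yy: "P y y = P x (P x y)"
    using flatness[of x y x] by (simp add: yx bil z z' flip: y_def)
  \<comment> \<open>The two sides of flatness differ by \<open>a\<close> times the bracket of
    \<open>x\<close> and \<open>y\<close>. A nonzero \<open>a\<close> would give the quotient plane
    the unit \<open>(y - b x) / a\<close>.\<close>
  have "(a * s) *\<^sub>R e3 = 0"
    using flatness[of x y y] by (simp add: z z' yy xy yx bil algebra_simps flip: y_def)
  then have a: "a = 0"
    using s by simp
  show ?thesis
  proof (cases "b = 0")
    case b: True
    \<comment> \<open>With \<open>b = 0\<close>, the product of \<open>y\<close> and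
      \<open>x\<close> is \<open>l\<close> times the bracket of \<open>x\<close> and
      \<open>y\<close>.\<close>
    define l where "l = (c - s) / s"
    have c: "c = s * (1 + l)"
      using s by (simp add: l_def field_simps)
    show ?thesis
    proof (cases "l = 0")
      case True
      then have "isomorphic_connections g31 P (normal_form H02)"
        using s by (intro isomorphic_normal_formI[of x y])
          (simp_all add: frame_def bilinear_of_table_def z bil xy yy a b c z' flip: y_def s_def)
      then show ?thesis
        by (intro exI[of _ H02]) simp
    next
      case False
      have "isomorphic_connections g31 P (normal_form (H05 l))"
        using s by (intro isomorphic_normal_formI[of x y])
          (simp_all add: frame_def bilinear_of_table_def z bil xy yy a b c z' flip: y_def s_def)
      then show ?thesis
        using False by (intro exI[of _ "H05 l"]) simp
    qed
  next
    case b: False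
    \<comment> \<open>The central correction gives \<open>P x m = b m\<close> exactly, and
      \<open>m\<close> has square \<open>b\<^sup>2 m\<close>; so \<open>e\<close> is idempotent.
      Subtracting \<open>b e\<close> from \<open>x\<close> leaves a vector \<open>n\<close> with
      \<open>P n e = 0\<close> and the remaining products with \<open>e\<close> and \<open>n\<close>
      central.\<close>
    define m where "m = y + (c / b) *\<^sub>R e3"
    define e where "e = (1 / b\<^sup>2) *\<^sub>R m"
    define n where "n = x - b *\<^sub>R e"
    define k where "k = - s / b\<^sup>2"
    define g where "g = (s - c) / b"
    have k: "k \<noteq> 0"
      using s b by (simp add: k_def)
    have Pm: "P m w = P y w" "P w m = P w y" for w
      by (simp_all add: m_def bil z z')
    have xy': "P x y = b *\<^sub>R m"
      using b by (simp add: m_def xy a algebra_simps)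
    have xm: "P x m = b *\<^sub>R m" and mx: "P m x = b *\<^sub>R m - s *\<^sub>R e3" and mm: "P m m = b\<^sup>2 *\<^sub>R m"
      by (simp_all add: Pm xy' yx yy bil power2_eq_square)
    have ee: "P e e = e"
      using b by (simp add: e_def bil mm)
    have xe: "P x e = b *\<^sub>R e"
      by (simp add: e_def bil xm)
    have ex: "P e x = b *\<^sub>R e + k *\<^sub>R e3"
      by (simp add: e_def k_def bil mx algebra_simps)
    have y: "P x x = b\<^sup>2 *\<^sub>R e - (c / b) *\<^sub>R e3"
      using b by (simp add: e_def m_def flip: y_def)
    have "P n n = P x x - b\<^sup>2 *\<^sub>R e - (b * k) *\<^sub>R e3"
      by (simp add: n_def bil ee xe ex algebra_simps power2_eq_square)
    also have "\<dots> = (- (c / b) - b * k) *\<^sub>R e3"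
      by (simp add: y algebra_simps)
    also have "- (c / b) - b * k = g"
      using b by (simp add: g_def k_def diff_divide_distrib power2_eq_square)
    finally have nn: "P n n = g *\<^sub>R e3" .
    have en: "P e n = k *\<^sub>R e3"
      by (simp add: n_def bil ee ex)
    have ne: "P n e = 0"
      by (simp add: n_def bil ee xe)
    have en': "area e n = k"
      using b by (simp add: n_def e_def m_def k_def area_commute[of y x] flip: s_def)
    have ne': "area n e = - k"
      by (simp add: area_commute[of n e] en')
    show ?thesis
    proof (cases "g = 0")
      case True
      then have "isomorphic_connections g31 P (normal_form H01)"
        using k by (intro isomorphic_normal_formI[of e n])
          (simp_all add: frame_def bilinear_of_table_def z ee en nn en')
      then show ?thesis
        by (intro exI[of _ H01]) simp
    next
      case False
      have "isomorphic_connections g31 P (normal_form H11)"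
        \<comment> \<open>The scale \<open>- k / g\<close> makes the square of the first basis
          vector equal to its bracket with \<open>e\<close>.\<close>
        using k False by (intro isomorphic_normal_formI[of "(- k / g) *\<^sub>R n" e])
          (simp_all add: frame_def bilinear_of_table_def z bil ee ne nn ne' field_simps)
      then show ?thesis
        by (intro exI[of _ H11]) simp
    qed
  qed
qed

text \<open>Modulo \<open>e3\<close>, the hypothesis makes each square \<open>x x\<close> a multiple
  of \<open>x\<close>, and polarisation makes the multiplier a linear form. Associativity of the
  quotient then forces this form to vanish.\<close>

lemma products_central:
  assumes z: "\<And>x. P e3 x = 0" and sq: "\<And>x. area x (P x x) = 0"
  shows "P x y = (P x y) $ 3 *\<^sub>R e3"
proof -
  have z': "P x e3 = 0" for x
    by (simp add: center_right z)
  define a b p q where "a = P e1 e1 $ 1" and "b = P e2 e2 $ 2"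
    and "p = P e1 e2 $ 1" and "q = P e1 e2 $ 2"
  have 11: "P e1 e1 $ 2 = 0" and 22: "P e2 e2 $ 1 = 0"
    using sq[of e1] sq[of e2] by (simp_all add: area_def)
  have t: "P e2 e1 = P e1 e2 - e3"
    using torsion[of e2 e1] by (simp add: area_def)
  have "a = 2 * q" "b = 2 * p"
    using sq[of "e1 + e2"] sq[of "e1 - e2"]
    by (simp_all add: bil t area_def 11 22 a_def b_def p_def q_def)
  obtain r r' r'' where e: "P e1 e1 = a *\<^sub>R e1 + r *\<^sub>R e3" "P e2 e2 = b *\<^sub>R e2 + r' *\<^sub>R e3"
    "P e1 e2 = p *\<^sub>R e1 + q *\<^sub>R e2 + r'' *\<^sub>R e3"
    by (rule that[of "P e1 e1 $ 3" "P e2 e2 $ 3" "P e1 e2 $ 3"])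
      (simp_all add: vec3_eq_iff a_def b_def p_def q_def 11 22)
  have "P e1 (p *\<^sub>R e1 + q *\<^sub>R e2) = P e2 (a *\<^sub>R e1)" "P e1 (b *\<^sub>R e2) = P e2 (p *\<^sub>R e1 + q *\<^sub>R e2)"
    using flatness[of e1 e2 e1] flatness[of e1 e2 e2]
    by (simp_all add: z z' t e bil)
  \<comment> \<open>With \<open>a = 2 q\<close> and \<open>b = 2 p\<close> these equations read
    \<open>q q = 2 q q\<close> and \<open>2 p p = p p\<close>.\<close>
  from arg_cong[OF this(1), of "\<lambda>v. v $ 2"] arg_cong[OF this(2), of "\<lambda>v. v $ 1"]
  have "q * q = a * q" "b * p = p * p"
    by (simp_all add: bil t e)
  with \<open>a = 2 * q\<close> \<open>b = 2 * p\<close> have 0: "a = 0" "b = 0" "p = 0" "q = 0"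
    by auto
  have "P x y $ 1 = 0 \<and> P x y $ 2 = 0"
    using arg_cong2[OF basis_expansion[of x] basis_expansion[of y], of P]
    by (simp add: bil z z' t e 0)
  then show ?thesis
    by (simp add: vec3_eq_iff)
qed

lemma normal_form_center_trivial_special:
  assumes z: "\<And>x. P e3 x = 0" and cent: "\<And>x y. P x y = B x y *\<^sub>R e3"
  shows "\<exists>h. admissible h \<and> isomorphic_connections g31 P (normal_form h)"
proof -
  have Bt: "B y x = B x y - area x y" for x y
    using torsion[of y x] by (simp add: cent flip: scaleR_diff_left)
  have Bz: "B e3 x = 0" for x
    using z[of x] by (simp add: cent)
  have Bbil: "B (x + y) w = B x w + B y w" "B w (x + y) = B w x + B w y"
    "B (x - y) w = B x w - B y w" "B w (x - y) = B w x - B w y"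
    "B (k *\<^sub>R x) w = k * B x w" "B w (k *\<^sub>R x) = k * B w x" for x y w k
    using bil(1)[of x y w] bil(2)[of w x y] bil(3)[of x y w] bil(4)[of w x y] bil(5)[of k x w] bil(6)[of w k x]
    by (simp_all add: cent flip: scaleR_add_left scaleR_diff_left)
  show ?thesis
  proof (cases "\<forall>x. B x x = 0")
    case True
    have "B (e1 + e2) (e1 + e2) = 0" "B e1 e1 = 0" "B e2 e2 = 0"
      using True by blast+
    then have "B e1 e2 = 1 / 2"
      by (simp add: Bbil Bt[of e2 e1]) (simp add: area_def)
    then have "isomorphic_connections g31 P (normal_form H06)"
      using True by (intro isomorphic_normal_formI[of e1 e2])
        (simp_all add: frame_def bilinear_of_table_def cent Bz, simp_all add: area_def)
    then show ?thesis
      by (intro exI[of _ H06]) simp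
  next
    case False
    then obtain v where v: "B v v \<noteq> 0"
      by blast
    have "v \<noteq> v $ 3 *\<^sub>R e3"
      using v Bz[of v] Bbil(5)[of "v $ 3" e3 v] by auto
    then have "\<not> (\<forall>y. area v y = 0)"
      by (simp only: area_0_iff not_False_eq_True)
    then obtain u0 where "area v u0 \<noteq> 0"
      by blast
    then have u0: "area u0 v \<noteq> 0"
      by (simp add: area_commute[of v u0])
    define t where "t = B v v / area u0 v"
    \<comment> \<open>Projecting along \<open>v\<close> makes \<open>B v u\<close> vanish, and the
      factor \<open>t\<close> gives \<open>area u v\<close> the value \<open>B v v\<close>, so that
      all structure constants share this factor.\<close>
    define u where "u = t *\<^sub>R u0 - (B v (t *\<^sub>R u0) / B v v) *\<^sub>R v"
    have uv: "area u v = B v v" and vu: "B v u = 0"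
      using u0 v by (simp_all add: u_def t_def Bbil)
    have Buv: "B u v = B v v"
      using Bt[of v u] by (simp add: uv vu)
    define l where "l = B u u / B v v"
    have l: "B u u = B v v * l"
      using v by (simp add: l_def)
    show ?thesis
    proof (cases "l = 0")
      case True
      then have "isomorphic_connections g31 P (normal_form H03)"
        \<comment> \<open>Since \<open>B u u = 0\<close> and \<open>B u v = B v v\<close>, the
          vector \<open>v - u\<close> also has square zero.\<close>
        using v by (intro isomorphic_normal_formI[of u "v - u"])
          (simp_all add: frame_def bilinear_of_table_def cent Bz Bbil uv vu Buv l)
      then show ?thesis
        by (intro exI[of _ H03]) simp
    next
      case False
      have "isomorphic_connections g31 P (normal_form (H61 l))"
        using v by (intro isomorphic_normal_formI[of u v])
          (simp_all add: frame_def bilinear_of_table_def cent Bz Bbil uv vu Buv l)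
      then show ?thesis
        using False by (intro exI[of _ "H61 l"]) simp
    qed
  qed
qed

lemma normal_form_exists: "\<exists>h. admissible h \<and> isomorphic_connections g31 P (normal_form h)"
proof -
  obtain f where f: "linear f" "\<And>x. P e3 x = f x *\<^sub>R e3" "f e3 = 0" "\<And>x y. f (P x y) = f x * f y"
    using center_action_in_center by blast
  show ?thesis
  proof (cases "\<forall>x. f x = 0")
    case False
    then show ?thesis
      using normal_form_center_acts[OF f] by blast
  next
    case True
    then have z: "P e3 x = 0" for x
      by (simp add: f)
    show ?thesis
    proof (cases "\<forall>x. area x (P x x) = 0")
      case True
      show ?thesis
        by (rule normal_form_center_trivial_special[OF z products_central[OF z]]) (use True in blast)
    next
      case False
      then show ?thesis
        using normal_form_center_trivial_generic[OF z] by blast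
    qed
  qed
qed

end

theorem proposition4:
  fixes nabla :: "real^3 \<Rightarrow> real^3 \<Rightarrow> real^3"
  assumes "flat_lie_algebra g31 nabla"
  shows "(\<forall>h. admissible h \<longrightarrow> flat_lie_algebra g31 (normal_form h)) \<and>
         (\<exists>!h. admissible h \<and> isomorphic_connections g31 nabla (normal_form h))"
proof (intro conjI allI impI)
  interpret flat_heisenberg nabla
    by unfold_locales (rule assms)
  show "\<exists>!h. admissible h \<and> isomorphic_connections g31 nabla (normal_form h)"
    using normal_form_exists normal_form_unique by blast
qed (rule flat_lie_algebra_normal_form)

end
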